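(* Let $n\ge0$ be an integer. Let $K$ be the complete graph on the vertices $\{\sigma,\rho,2\rho,2^2\rho,\dots,2^n\rho\}$ considered as a directed graph, with edges labelled by elements of $A_{C_2}^\vee(n)$ as in the context; each directed path is identified with the product in $A_{C_2}^\vee(n)$ of the labels of its edges. I. For $i\ge1$, $j\ge0$ with $i+j\le n$, the antipode $c(\xi_i^{2^j})\in A_{C_2}^\vee(n)$ is the sum of all directed paths from the vertex $2^j\rho$ to the vertex $2^{i+j}\rho$ in $K$. II. Similarly, for $0\le i\le n$, the antipode $c(\tau_i)\in A_{C_2}^\vee(n)$ is the sum of all directed paths from the vertex $\sigma$ to the vertex $2^i\rho$ in $K$.
   Context: Let $\mathbb{M}_2=\mathbb{F}_2[a,u]\oplus\frac{\mathbb{F}_2[a,u]}{(a^\infty,u^\infty)}\{\theta\}$ be the bigraded coefficient ring ($RO(C_2)$-graded homology of a point with coefficients in the constant Mackey functor $\underline{\mathbb{F}}_2$), $|a|=(-1,-1)$, $|u|=(0,-1)$. Let $A_{C_2}^\vee(n)=\mathbb{M}_2[\xi_1,\dots,\xi_n,\tau_0,\dots,\tau_n]/(\xi_i^{2^{n-i+1}},\ \tau_i^2=(u+a\tau_0)\xi_{i+1}+a\tau_{i+1})$ with $\xi_{n+1}=\tau_{n+1}=0$, a quotient of the $C_2$-equivariant dual Steenrod algebra, with Hopf algebroid structure over $\mathbb{M}_2$ inherited from the latter: coproduct $\psi(\xi_m)=\sum_{k=0}^m\xi_{m-k}^{2^k}\otimes\xi_k$, $\psi(\tau_m)=\tau_m\otimes1+\sum_{k=0}^m\xi_{m-k}^{2^k}\otimes\tau_k$,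 where $\xi_0=1$. The antipode (conjugation) $c$ is the ring homomorphism which on generators satisfies $c(\xi_0)=1$, $\sum_{k=0}^m\xi_{m-k}^{2^k}c(\xi_k)=0$ for $m\ge1$, and $\tau_m+\sum_{k=0}^m\xi_{m-k}^{2^k}c(\tau_k)=0$ for $m\ge0$. Here $\sigma$ is the sign representation and $\rho=1+\sigma$ the regular representation of $C_2$; the vertices of $K$ are $n+2$ distinct symbols. Every edge of $K$ is directed towards the later vertex in the order $\sigma,\rho,2\rho,\dots,2^n\rho$; the edge $2^a\rho\to2^b\rho$ ($a<b$) is labelled $\xi_{b-a}^{2^a}$ and the edge $\sigma\to2^a\rho$ is labelled $\tau_a$. Directed paths here are non-degenerate (no loops). *)

theory Defs
  imports
    "HOL-Library.Poly_Mapping"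
    "HOL-Library.Product_Plus"
    "HOL-Library.Z2"
    "HOL-Algebra.QuotRing"
    "Graph_Theory.Graph_Theory"
begin

section \<open>The coefficient ring\<close>

text \<open>
  Laurent polynomials over the field with two elements; the key \<open>(i, j)\<close> stands for
  \<open>a\<^sup>i u\<^sup>j\<close>. The module \<open>F\<^sub>2[a,u]/(a\<^sup>\<infinity>,u\<^sup>\<infinity>)\<close> is the quotient of the Laurent polynomials
  by the span of all monomials with a nonnegative exponent, so it has the basis
  \<open>a\<^sup>i u\<^sup>j\<close> with \<open>i, j < 0\<close>; \<open>neg_part\<close> is the projection onto these representatives.
\<close>

type_synonym laurent = "(int \<times> int) \<Rightarrow>\<^sub>0 bit"

definition pos_exps :: "(int \<times> int) set" where
  "pos_exps = {(i, j). 0 \<le> i \<and> 0 \<le> j}"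

definition neg_exps :: "(int \<times> int) set" where
  "neg_exps = {(i, j). i < 0 \<and> j < 0}"

lift_definition neg_part :: "laurent \<Rightarrow> laurent" is
  "\<lambda>f k. if k \<in> neg_exps then f k else 0"
  by (erule rev_finite_subset) auto

lemma lookup_neg_part: "Poly_Mapping.lookup (neg_part f) k = (if k \<in> neg_exps then Poly_Mapping.lookup f k else 0)"
  by transfer simp

lemma keys_neg_part: "Poly_Mapping.keys (neg_part f) \<subseteq> neg_exps"
  by (auto simp: in_keys_iff lookup_neg_part split: if_splits)

lemma neg_part_id: "Poly_Mapping.keys f \<subseteq> neg_exps \<Longrightarrow> neg_part f = f"
  by (rule poly_mapping_eqI) (auto simp: lookup_neg_part in_keys_iff)

lemma neg_part_add: "neg_part (f + g) = neg_part f + neg_part g"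
  by (rule poly_mapping_eqI) (auto simp: lookup_neg_part lookup_add)

lemma neg_part_eq_0_iff: "neg_part f = 0 \<longleftrightarrow> Poly_Mapping.keys f \<inter> neg_exps = {}"
  by (auto simp: poly_mapping_eq_iff fun_eq_iff lookup_neg_part in_keys_iff split: if_splits)

lemma neg_part_0 [simp]: "neg_part 0 = 0"
  by (simp add: neg_part_eq_0_iff)

lemma neg_part_mult:
  assumes "Poly_Mapping.keys p \<subseteq> pos_exps"
  shows "neg_part (p * neg_part f) = neg_part (p * f)"
proof -
  define g where "g = f - neg_part f"
  have f: "f = neg_part f + g"
    by (simp add: g_def)
  have "Poly_Mapping.keys g \<inter> neg_exps = {}"
    by (auto simp: g_def in_keys_iff lookup_minus lookup_neg_part)
  then have "Poly_Mapping.keys (p * g) \<inter> neg_exps = {}"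
  proof -
    have "x + y \<notin> neg_exps" if "x \<in> pos_exps" "y \<notin> neg_exps" for x y
      using that by (cases x; cases y) (auto simp: pos_exps_def neg_exps_def)
    then show ?thesis
      using keys_mult[of p g] assms \<open>Poly_Mapping.keys g \<inter> neg_exps = {}\<close> by blast
  qed
  then have "neg_part (p * g) = 0"
    by (simp add: neg_part_eq_0_iff)
  then show ?thesis
    by (subst (2) f) (simp add: distrib_left neg_part_add)
qed

lemma keys_mult_pos:
  fixes p q :: laurent
  assumes "Poly_Mapping.keys p \<subseteq> pos_exps" "Poly_Mapping.keys q \<subseteq> pos_exps"
  shows "Poly_Mapping.keys (p * q) \<subseteq> pos_exps"
proof -
  have "x + y \<in> pos_exps" if "x \<in> pos_exps" "y \<in> pos_exps" for x y
    using that by (cases x; cases y) (auto simp: pos_exps_def)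
  then show ?thesis
    using keys_mult[of p q] assms by blast
qed

text \<open>
  The pair \<open>(p, q)\<close> stands for \<open>p + q \<theta>\<close>, so the basis element \<open>(0, a\<^sup>-\<^sup>i u\<^sup>-\<^sup>j)\<close> is
  \<open>\<theta>/(a\<^sup>i u\<^sup>j)\<close> with \<open>i, j \<ge> 1\<close> (conventions that start at \<open>i, j \<ge> 0\<close>
  merely relabel the basis). The summand \<open>F\<^sub>2[a,u]/(a\<^sup>\<infinity>,u\<^sup>\<infinity>){\<theta>}\<close> is a
  square-zero ideal. The bigrading plays no role for the ring structure and is not recorded.
\<close>

typedef m2 = "{(p :: laurent, q :: laurent). Poly_Mapping.keys p \<subseteq> pos_exps \<and> Poly_Mapping.keys q \<subseteq> neg_exps}"
  by (rule exI[of _ "(0, 0)"]) simp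

setup_lifting type_definition_m2

instantiation m2 :: comm_ring_1
begin

lift_definition zero_m2 :: m2 is "(0, 0)"
  by simp

lift_definition one_m2 :: m2 is "(1, 0)"
  by (auto simp: pos_exps_def zero_prod_def)

lift_definition plus_m2 :: "m2 \<Rightarrow> m2 \<Rightarrow> m2" is
  "\<lambda>(p, q) (p', q'). (p + p', q + q')"
proof clarify
  fix p q p' q' :: laurent
  assume "Poly_Mapping.keys p \<subseteq> pos_exps" "Poly_Mapping.keys q \<subseteq> neg_exps"
    "Poly_Mapping.keys p' \<subseteq> pos_exps" "Poly_Mapping.keys q' \<subseteq> neg_exps"
  then show "Poly_Mapping.keys (p + p') \<subseteq> pos_exps \<and> Poly_Mapping.keys (q + q') \<subseteq> neg_exps"
    using Poly_Mapping.keys_add[of p p'] Poly_Mapping.keys_add[of q q'] by blast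
qed

lift_definition uminus_m2 :: "m2 \<Rightarrow> m2" is
  "\<lambda>(p, q). (- p, - q)"
  by (auto simp: in_keys_iff)

lift_definition minus_m2 :: "m2 \<Rightarrow> m2 \<Rightarrow> m2" is
  "\<lambda>(p, q) (p', q'). (p - p', q - q')"
proof clarify
  fix p q p' q' :: laurent
  assume "Poly_Mapping.keys p \<subseteq> pos_exps" "Poly_Mapping.keys q \<subseteq> neg_exps"
    "Poly_Mapping.keys p' \<subseteq> pos_exps" "Poly_Mapping.keys q' \<subseteq> neg_exps"
  then show "Poly_Mapping.keys (p - p') \<subseteq> pos_exps \<and> Poly_Mapping.keys (q - q') \<subseteq> neg_exps"
    using keys_diff[of p p'] keys_diff[of q q'] by blast
qed

lift_definition times_m2 :: "m2 \<Rightarrow> m2 \<Rightarrow> m2" is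
  "\<lambda>(p, q) (p', q'). (p * p', neg_part (p * q' + p' * q))"
  by (clarsimp simp: keys_neg_part keys_mult_pos)

instance
proof
  fix x y z :: m2
  show "x + y + z = x + (y + z)" by transfer (auto simp: add_ac)
  show "x + y = y + x" by transfer (auto simp: add_ac)
  show "0 + x = x" by transfer auto
  show "- x + x = 0" by transfer auto
  show "x - y = x + - y" by transfer auto
  show "x * y = y * x" by transfer (auto simp: mult_ac add_ac)
  show "1 * x = x" by transfer (auto simp: neg_part_id)
  show "(x + y) * z = x * z + y * z"
    by transfer (auto simp: neg_part_add algebra_simps)
  show "0 \<noteq> (1 :: m2)" by transfer auto
  show "x * y * z = x * (y * z)"
    by transfer (auto simp: neg_part_add neg_part_mult keys_mult_pos algebra_simps)
qed

end

lift_definition m2_a :: m2 is "(Poly_Mapping.single (1, 0) 1, 0)"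
  by (simp add: pos_exps_def)

lift_definition m2_u :: m2 is "(Poly_Mapping.single (0, 1) 1, 0)"
  by (simp add: pos_exps_def)


section \<open>The quotient of the dual Steenrod algebra\<close>

datatype gen = Xi nat | Tau nat

text \<open>Polynomials over \<open>m2\<close>: a key of type \<open>gen \<Rightarrow>\<^sub>0 nat\<close> is a monomial in the generators.\<close>

type_synonym gpoly = "(gen \<Rightarrow>\<^sub>0 nat) \<Rightarrow>\<^sub>0 m2"

definition gvar :: "gen \<Rightarrow> gpoly" where
  "gvar x = Poly_Mapping.single (Poly_Mapping.single x 1) 1"

definition gconst :: "m2 \<Rightarrow> gpoly" where
  "gconst r = Poly_Mapping.single 0 r"

definition gens :: "nat \<Rightarrow> gen set" where
  "gens n = Xi ` {1..n} \<union> Tau ` {0..n}"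

definition gpoly_ring :: "nat \<Rightarrow> gpoly ring" where
  "gpoly_ring n =
     \<lparr>carrier = {p. \<forall>m \<in> Poly_Mapping.keys p. Poly_Mapping.keys m \<subseteq> gens n},
      monoid.mult = (*), one = 1, zero = 0, add = (+)\<rparr>"

text \<open>The conventions \<open>\<xi>\<^sub>0 = 1\<close> and \<open>\<xi>\<^bsub>n+1\<^esub> = \<tau>\<^bsub>n+1\<^esub> = 0\<close> are built in.\<close>

definition xi_poly :: "nat \<Rightarrow> nat \<Rightarrow> gpoly" where
  "xi_poly n i = (if i = 0 then 1 else if i \<le> n then gvar (Xi i) else 0)"

definition tau_poly :: "nat \<Rightarrow> nat \<Rightarrow> gpoly" where
  "tau_poly n i = (if i \<le> n then gvar (Tau i) else 0)"

definition A_relators :: "nat \<Rightarrow> gpoly set" where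
  "A_relators n =
     {xi_poly n i ^ (2 ^ (n - i + 1)) | i. 1 \<le> i \<and> i \<le> n} \<union>
     {tau_poly n i ^ 2 -
        ((gconst m2_u + gconst m2_a * tau_poly n 0) * xi_poly n (i + 1)
          + gconst m2_a * tau_poly n (i + 1)) | i. i \<le> n}"

definition A_ideal :: "nat \<Rightarrow> gpoly set" where
  "A_ideal n = Idl\<^bsub>gpoly_ring n\<^esub> (A_relators n)"

definition A :: "nat \<Rightarrow> gpoly set ring" where
  "A n = gpoly_ring n Quot A_ideal n"

definition xi :: "nat \<Rightarrow> nat \<Rightarrow> gpoly set" where
  "xi n i = A_ideal n +>\<^bsub>gpoly_ring n\<^esub> xi_poly n i"

definition tau :: "nat \<Rightarrow> nat \<Rightarrow> gpoly set" where
  "tau n i = A_ideal n +>\<^bsub>gpoly_ring n\<^esub> tau_poly n i"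

lemma gpoly_ring_cring: "cring (gpoly_ring n)"
proof -
  let ?S = "{p :: gpoly. \<forall>m \<in> Poly_Mapping.keys p. Poly_Mapping.keys m \<subseteq> gens n}"
  have add: "p + q \<in> ?S" if "p \<in> ?S" "q \<in> ?S" for p q
    using that keys_add[of p q] by blast
  have mult: "p * q \<in> ?S" if "p \<in> ?S" "q \<in> ?S" for p q
  proof clarify
    fix m x assume "m \<in> Poly_Mapping.keys (p * q)" "x \<in> Poly_Mapping.keys m"
    then obtain m1 m2 where "m = m1 + m2" "m1 \<in> Poly_Mapping.keys p" "m2 \<in> Poly_Mapping.keys q"
      using keys_mult[of p q] by blast
    with \<open>x \<in> Poly_Mapping.keys m\<close> that keys_add[of m1 m2] show "x \<in> gens n" by blast
  qed
  have uminus: "- p \<in> ?S" if "p \<in> ?S" for p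
    using that by (auto simp: in_keys_iff)
  have ops:
    "x \<oplus>\<^bsub>gpoly_ring n\<^esub> y = x + y" "x \<otimes>\<^bsub>gpoly_ring n\<^esub> y = x * y"
    "\<zero>\<^bsub>gpoly_ring n\<^esub> = 0" "\<one>\<^bsub>gpoly_ring n\<^esub> = 1" for x y
    by (simp_all add: gpoly_ring_def)
  have carr: "carrier (gpoly_ring n) = ?S"
    by (simp add: gpoly_ring_def)
  have inv: "\<exists>y\<in>?S. y + x = 0" if "x \<in> ?S" for x
    by (rule bexI[of _ "- x"]) (rule add.left_inverse uminus that)+
  have zero_one: "0 \<in> ?S" "1 \<in> ?S"
    by simp_all
  have "abelian_group (gpoly_ring n)"
    by (rule abelian_groupI, unfold ops carr)
      (assumption | rule add add.assoc add.commute add_0 zero_one inv)+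
  moreover have "comm_monoid (gpoly_ring n)"
    by (rule comm_monoidI, unfold ops carr)
      (assumption | rule mult mult.assoc mult.commute mult_1 zero_one)+
  ultimately show ?thesis
    by (rule cringI) (unfold ops, rule distrib_right)
qed

lemma xi_poly_closed: "xi_poly n i \<in> carrier (gpoly_ring n)"
  by (auto simp: gpoly_ring_def xi_poly_def gvar_def gens_def)

lemma tau_poly_closed: "tau_poly n i \<in> carrier (gpoly_ring n)"
  by (auto simp: gpoly_ring_def tau_poly_def gvar_def gens_def)

lemma gconst_closed: "gconst r \<in> carrier (gpoly_ring n)"
  by (auto simp: gpoly_ring_def gconst_def split: if_splits)

lemma A_relators_closed: "A_relators n \<subseteq> carrier (gpoly_ring n)"
proof -
  interpret R: cring "gpoly_ring n" by (rule gpoly_ring_cring)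
  have add: "p + q \<in> carrier (gpoly_ring n)"
    if "p \<in> carrier (gpoly_ring n)" "q \<in> carrier (gpoly_ring n)" for p q
    using R.add.m_closed[OF that] by (simp add: gpoly_ring_def)
  have mult: "p * q \<in> carrier (gpoly_ring n)"
    if "p \<in> carrier (gpoly_ring n)" "q \<in> carrier (gpoly_ring n)" for p q
    using R.m_closed[OF that] by (simp add: gpoly_ring_def)
  have uminus: "- p \<in> carrier (gpoly_ring n)" if "p \<in> carrier (gpoly_ring n)" for p
    using that by (auto simp: gpoly_ring_def in_keys_iff)
  have pow: "p ^ k \<in> carrier (gpoly_ring n)" if "p \<in> carrier (gpoly_ring n)" for p and k :: nat
  proof (induction k)
    case 0
    show ?case using R.one_closed by (simp add: gpoly_ring_def)
  next
    case (Suc k)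
    show ?case unfolding power_Suc by (rule mult[OF that Suc])
  qed
  have minus: "p - q \<in> carrier (gpoly_ring n)"
    if "p \<in> carrier (gpoly_ring n)" "q \<in> carrier (gpoly_ring n)" for p q
    using add[OF that(1) uminus[OF that(2)]] by simp
  show ?thesis
    unfolding A_relators_def
    by (intro subsetI; elim UnE CollectE exE conjE; hypsubst)
      (intro minus add mult pow xi_poly_closed tau_poly_closed gconst_closed)+
qed

lemma A_ideal_ideal: "ideal (A_ideal n) (gpoly_ring n)"
  unfolding A_ideal_def
  by (rule ring.genideal_ideal[OF cring.axioms(1)[OF gpoly_ring_cring] A_relators_closed])

lemma A_cring: "cring (A n)"
  unfolding A_def by (rule ideal.quotient_is_cring[OF A_ideal_ideal gpoly_ring_cring])

lemma xi_closed: "xi n i \<in> carrier (A n)"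
  unfolding xi_def A_def FactRing_def A_RCOSETS_def' partial_object.select_convs
  using xi_poly_closed by blast

lemma tau_closed: "tau n i \<in> carrier (A n)"
  unfolding tau_def A_def FactRing_def A_RCOSETS_def' partial_object.select_convs
  using tau_poly_closed by blast


section \<open>The antipode\<close>

text \<open>
  \<open>c\<close> is only required to be a ring homomorphism, not an \<open>m2\<close>-algebra homomorphism: the
  antipode of the Hopf algebroid interchanges the left and right units, e.g. it sends \<open>u\<close> to
  \<open>u + a \<tau>\<^sub>0\<close>.
\<close>

definition is_antipode :: "nat \<Rightarrow> (gpoly set \<Rightarrow> gpoly set) \<Rightarrow> bool" where
  "is_antipode n c \<longleftrightarrow>
     c \<in> ring_hom (A n) (A n) \<and>
     c (xi n 0) = \<one>\<^bsub>A n\<^esub> \<and>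
     (\<forall>m. 1 \<le> m \<and> m \<le> n \<longrightarrow>
        (\<Oplus>\<^bsub>A n\<^esub> k \<in> {0..m}. (xi n (m - k) [^]\<^bsub>A n\<^esub> ((2::nat) ^ k)) \<otimes>\<^bsub>A n\<^esub> c (xi n k)) = \<zero>\<^bsub>A n\<^esub>) \<and>
     (\<forall>m \<le> n.
        tau n m \<oplus>\<^bsub>A n\<^esub>
        (\<Oplus>\<^bsub>A n\<^esub> k \<in> {0..m}. (xi n (m - k) [^]\<^bsub>A n\<^esub> ((2::nat) ^ k)) \<otimes>\<^bsub>A n\<^esub> c (tau n k)) = \<zero>\<^bsub>A n\<^esub>)"


section \<open>The graph\<close>

text \<open>\<open>Sigma_v\<close> is the vertex \<open>\<sigma>\<close>, and \<open>Rho_v i\<close> is the vertex \<open>2\<^sup>i \<rho>\<close>.\<close>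

datatype vertex = Sigma_v | Rho_v nat

fun before :: "vertex \<Rightarrow> vertex \<Rightarrow> bool" where
  "before Sigma_v (Rho_v b) \<longleftrightarrow> True"
| "before (Rho_v a) (Rho_v b) \<longleftrightarrow> a < b"
| "before _ Sigma_v \<longleftrightarrow> False"

definition K :: "nat \<Rightarrow> vertex pair_pre_digraph" where
  "K n = (let V = insert Sigma_v (Rho_v ` {0..n})
          in \<lparr>pverts = V, parcs = {(v, w). v \<in> V \<and> w \<in> V \<and> before v w}\<rparr>)"

fun edge_label :: "nat \<Rightarrow> vertex \<times> vertex \<Rightarrow> gpoly set" where
  "edge_label n (Rho_v a, Rho_v b) = xi n (b - a) [^]\<^bsub>A n\<^esub> ((2::nat) ^ a)"
| "edge_label n (Sigma_v, Rho_v a) = tau n a"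
| "edge_label n (_, Sigma_v) = undefined" \<comment> \<open>no edge of \<open>K n\<close> ends at \<open>\<sigma>\<close>\<close>

definition directed_paths :: "nat \<Rightarrow> vertex \<Rightarrow> vertex \<Rightarrow> (vertex \<times> vertex) list set" where
  "directed_paths n v w = {p. pre_digraph.apath (with_proj (K n)) v p w}"

definition path_product :: "nat \<Rightarrow> (vertex \<times> vertex) list \<Rightarrow> gpoly set" where
  "path_product n p = foldr (\<lambda>e x. edge_label n e \<otimes>\<^bsub>A n\<^esub> x) p \<one>\<^bsub>A n\<^esub>"

definition path_sum :: "nat \<Rightarrow> vertex \<Rightarrow> vertex \<Rightarrow> gpoly set" where
  "path_sum n v w = (\<Oplus>\<^bsub>A n\<^esub> p \<in> directed_paths n v w. path_product n p)"

lemma finite_directed_paths: "finite (directed_paths n v w)"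
proof -
  let ?V = "insert Sigma_v (Rho_v ` {0..n})"
  have "finite (parcs (K n))"
    by (rule finite_subset[of _ "?V \<times> ?V"]) (auto simp: K_def)
  then interpret pair_fin_digraph "K n"
    by unfold_locales (auto simp: K_def Let_def)
  show ?thesis
    unfolding directed_paths_def by (rule apaths_finite)
qed

end

theory Submission
  imports Defs
begin

text \<open>
  In characteristic two the defining relations of the antipode solve for \<open>c(\<xi>\<^sub>m)\<close> and
  \<open>c(\<tau>\<^sub>m)\<close> in terms of the earlier values, and raising to the power \<open>2\<^sup>j\<close> is additive. The
  resulting recursions are those satisfied by the sums over directed paths when a path is split
  at its last edge; a directed walk never repeats a vertex because edges increase the vertex order.
\<close>

section \<open>Characteristic two\<close>

lemma (in cring) add_self_char_2:
  assumes "\<one> \<oplus> \<one> = \<zero>" "x \<in> carrier R"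
  shows "x \<oplus> x = \<zero>"
proof -
  have "x \<oplus> x = x \<otimes> (\<one> \<oplus> \<one>)"
    using assms(2) by (simp add: r_distr)
  then show ?thesis
    using assms by simp
qed

text \<open>Since \<open>y \<oplus> y = \<zero>\<close>, cancelling \<open>y\<close> suffices. This
  solves a relation with sum zero for one of its terms, without signs.\<close>

lemma (in cring) eq_if_add_eq_zero_char_2:
  assumes "\<one> \<oplus> \<one> = \<zero>" "x \<in> carrier R" "y \<in> carrier R" "x \<oplus> y = \<zero>"
  shows "x = y"
  using assms add_self_char_2[OF assms(1,3)] by (metis add.right_cancel)

text \<open>Squaring is additive because the two equal cross terms add up to zero; the power
  \<open>2 ^ Suc j\<close> is the square of the power \<open>2 ^ j\<close>, so induction on
  \<open>j\<close> finishes.\<close>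

lemma (in cring) frobenius_add_char_2:
  assumes char: "\<one> \<oplus> \<one> = \<zero>" and x: "x \<in> carrier R" and y: "y \<in> carrier R"
  shows "(x \<oplus> y) [^] ((2::nat) ^ j) = x [^] ((2::nat) ^ j) \<oplus> y [^] ((2::nat) ^ j)"
proof (induction j)
  case 0
  show ?case using x y by simp
next
  case (Suc j)
  have square: "(s \<oplus> t) \<otimes> (s \<oplus> t) = s \<otimes> s \<oplus> t \<otimes> t"
    if s: "s \<in> carrier R" and t: "t \<in> carrier R" for s t
  proof -
    have "(s \<oplus> t) \<otimes> (s \<oplus> t) = s \<otimes> s \<oplus> (s \<otimes> t \<oplus> s \<otimes> t) \<oplus> t \<otimes> t"
      using s t by algebra
    also have "s \<otimes> t \<oplus> s \<otimes> t = \<zero>"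
      using s t by (simp add: add_self_char_2[OF char])
    finally show ?thesis using s t by simp
  qed
  have double: "z [^] ((2::nat) ^ Suc j) = z [^] ((2::nat) ^ j) \<otimes> z [^] ((2::nat) ^ j)"
    if "z \<in> carrier R" for z
    using that by (simp add: nat_pow_mult mult_2)
  show ?case
    using x y by (simp add: double Suc.IH square del: power_Suc)
qed

lemma (in cring) frobenius_finsum_char_2:
  assumes "\<one> \<oplus> \<one> = \<zero>" "finite I" "f \<in> I \<rightarrow> carrier R"
  shows "(\<Oplus>i\<in>I. f i) [^] ((2::nat) ^ j) = (\<Oplus>i\<in>I. f i [^] ((2::nat) ^ j))"
  using assms(2,3)
proof (induction I rule: finite_induct)
  case empty
  \<comment> \<open>The exponent \<open>2 ^ j\<close> is nonzero, so the power of the empty sum is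
    again \<zero>; a zeroth power would be \<one>.\<close>
  show ?case by (simp add: nat_pow_zero)
next
  case (insert i I)
  then have f: "f \<in> I \<rightarrow> carrier R" "f i \<in> carrier R" by auto
  then have "(\<lambda>i. f i [^] ((2::nat) ^ j)) \<in> I \<rightarrow> carrier R" by auto
  with insert f show ?case
    by (simp add: frobenius_add_char_2[OF assms(1)])
qed

section \<open>Characteristic two of \<open>A n\<close>\<close>

lemma m2_one_add_one: "(1 :: m2) + 1 = 0"
proof transfer
  have "(1 :: laurent) + 1 = 0"
    by (rule poly_mapping_eqI, subst lookup_add) (simp add: lookup_one when_def)
  then show "(\<lambda>(p :: laurent, q :: laurent) (p', q'). (p + p', q + q')) (1, 0) (1, 0) = (0, 0)"
    by simp
qed

text \<open>The quotient map preserves zero, one and sums, so the identity descends from the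
  polynomial ring, where it holds coefficientwise by the one in \<open>m2\<close>.\<close>

lemma A_one_add_one: "\<one>\<^bsub>A n\<^esub> \<oplus>\<^bsub>A n\<^esub> \<one>\<^bsub>A n\<^esub> = \<zero>\<^bsub>A n\<^esub>"
proof -
  interpret h: ring_hom_ring "gpoly_ring n" "A n" "a_r_coset (gpoly_ring n) (A_ideal n)"
    unfolding A_def by (rule ideal.rcos_ring_hom_ring[OF A_ideal_ideal])
  have "(1 :: gpoly) + 1 = 0"
    by (rule poly_mapping_eqI, subst lookup_add)
      (simp add: lookup_one when_def m2_one_add_one[unfolded one_add_one])
  then have "\<one>\<^bsub>gpoly_ring n\<^esub> \<oplus>\<^bsub>gpoly_ring n\<^esub> \<one>\<^bsub>gpoly_ring n\<^esub> = \<zero>\<^bsub>gpoly_ring n\<^esub>"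
    by (simp add: gpoly_ring_def)
  then show ?thesis
    by (metis h.hom_add h.hom_one h.hom_zero h.R.one_closed)
qed

text \<open>Makes the coefficient of the term \<open>k = m\<close> in the antipode relations equal
  to one, so that they can be solved for the top value.\<close>

lemma xi_0: "xi n 0 = \<one>\<^bsub>A n\<^esub>"
  by (simp add: xi_def xi_poly_def A_def FactRing_def) (simp add: gpoly_ring_def)


section \<open>Directed paths in the complete graph\<close>

lemma before_trans: "before u v \<Longrightarrow> before v w \<Longrightarrow> before u w"
  by (cases u; cases v; cases w) auto

lemma before_irrefl: "\<not> before v v"
  by (cases v) auto

lemma in_parcs_K:
  "(u, v) \<in> parcs (K n) \<longleftrightarrow> u \<in> pverts (K n) \<and> v \<in> pverts (K n) \<and> before u v"
  by (auto simp: K_def Let_def)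

lemma pverts_K: "pverts (K n) = insert Sigma_v (Rho_v ` {0..n})"
  by (simp add: K_def Let_def)

lemma wf_digraph_K: "wf_digraph (with_proj (K n))"
  by unfold_locales (auto simp: in_parcs_K)

text \<open>Every arc goes up in \<open>before\<close>, and by transitivity comparing neighbours on
  the walk is enough.\<close>

lemma sorted_awalk_verts_K:
  assumes "pre_digraph.awalk (with_proj (K n)) u p v"
  shows "sorted_wrt before (pre_digraph.awalk_verts (with_proj (K n)) u p)"
proof -
  interpret wf_digraph "with_proj (K n)" by (rule wf_digraph_K)
  have trans: "transp before" by (auto intro: transpI before_trans)
  show ?thesis
    using assms
  proof (induction p arbitrary: u)
    case Nil
    show ?case by simp
  next
    case (Cons e p)
    then have e: "e \<in> parcs (K n)" "awalk (snd e) p v" by (auto simp: awalk_Cons_iff)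
    \<comment> \<open>The rest of the walk starts at the head of \<open>e\<close>; exposing that
      vertex leaves just one new comparison, between the two ends of \<open>e\<close>.\<close>
    obtain vs where vs: "awalk_verts (snd e) p = snd e # vs"
      using e(2) by (cases p) (auto simp: awalk_Cons_iff)
    have "before (fst e) (snd e)"
      using e(1) by (cases e) (simp add: in_parcs_K)
    then show ?case
      using Cons.IH[OF e(2)] by (simp add: vs sorted_wrt2[OF trans] del: sorted_wrt.simps(2))
  qed
qed

text \<open>A list sorted by an irreflexive relation has no repetitions, so every walk is a path.
  Distinctness of vertices then never has to be checked when an edge is appended or removed.\<close>

lemma directed_paths_awalk:
  "directed_paths n u v = {p. pre_digraph.awalk (with_proj (K n)) u p v}"
proof -
  interpret wf_digraph "with_proj (K n)" by (rule wf_digraph_K)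
  have "distinct vs" if "sorted_wrt before vs" for vs
    using that by (induction vs) (auto simp: before_irrefl)
  then show ?thesis
    by (auto simp: directed_paths_def apath_def dest: sorted_awalk_verts_K)
qed

text \<open>Transitivity along the walk. Hence there are no nonempty closed walks, and vertices
  before the source are unreachable.\<close>

lemma directed_paths_before:
  assumes "p \<in> directed_paths n u v"
  shows "p = [] \<and> u = v \<or> p \<noteq> [] \<and> before u v"
proof -
  interpret wf_digraph "with_proj (K n)" by (rule wf_digraph_K)
  have "awalk u p v"
    using assms by (simp add: directed_paths_awalk)
  then show ?thesis
  proof (induction p arbitrary: u)
    case Nil
    then show ?case by (simp add: awalk_Nil_iff)
  next
    case (Cons e p)
    then have "e \<in> parcs (K n)" "fst e = u" "awalk (snd e) p v" by (auto simp: awalk_Cons_iff)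
    with Cons.IH show ?case
      by (cases e) (auto simp: in_parcs_K intro: before_trans)
  qed
qed

lemma directed_paths_self: "v \<in> pverts (K n) \<Longrightarrow> directed_paths n v v = {[]}"
proof -
  assume v: "v \<in> pverts (K n)"
  interpret wf_digraph "with_proj (K n)" by (rule wf_digraph_K)
  have "[] \<in> directed_paths n v v"
    using v by (simp add: directed_paths_awalk awalk_Nil_iff)
  then show ?thesis
    using directed_paths_before before_irrefl by blast
qed

lemma directed_paths_empty: "u \<noteq> v \<Longrightarrow> \<not> before u v \<Longrightarrow> directed_paths n u v = {}"
  using directed_paths_before by blast

text \<open>With distinct endpoints the empty path is excluded, so there is a last edge.
  Predecessors of \<open>w\<close> that cannot be reached from \<open>u\<close> are harmless: they
  contribute the empty set.\<close>

lemma directed_paths_last_edge: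
  assumes "u \<noteq> w"
  shows "directed_paths n u w =
    (\<Union>v\<in>{v. (v, w) \<in> parcs (K n)}. (\<lambda>p. p @ [(v, w)]) ` directed_paths n u v)"
proof -
  interpret wf_digraph "with_proj (K n)" by (rule wf_digraph_K)
  have snoc: "p @ [e] \<in> directed_paths n u w \<longleftrightarrow>
      e \<in> parcs (K n) \<and> snd e = w \<and> p \<in> directed_paths n u (fst e)" for p e
    by (cases e) (auto simp: directed_paths_awalk awalk_Cons_iff awalk_Nil_iff in_parcs_K)
  show ?thesis
  proof (intro equalityI subsetI)
    fix q assume q: "q \<in> directed_paths n u w"
    then have "q \<noteq> []"
      using assms by (auto dest: directed_paths_before)
    then obtain p e where "q = p @ [e]" by (cases q rule: rev_cases) auto
    with q show "q \<in> (\<Union>v\<in>{v. (v, w) \<in> parcs (K n)}. (\<lambda>p. p @ [(v, w)]) ` directed_paths n u v)"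
      by (cases e) (auto simp: snoc)
  next
    fix q assume "q \<in> (\<Union>v\<in>{v. (v, w) \<in> parcs (K n)}. (\<lambda>p. p @ [(v, w)]) ` directed_paths n u v)"
    then show "q \<in> directed_paths n u w" by (auto simp: snoc)
  qed
qed


section \<open>Sums over paths\<close>

lemma edge_label_closed: "e \<in> parcs (K n) \<Longrightarrow> edge_label n e \<in> carrier (A n)"
proof -
  assume e: "e \<in> parcs (K n)"
  interpret A: cring "A n" by (rule A_cring)
  show ?thesis
    \<comment> \<open>The case of an edge into \<open>Sigma_v\<close>, whose label is
      \<open>undefined\<close>, is ruled out by \<open>before\<close>.\<close>
    using e by (cases "(n, e)" rule: edge_label.cases) (auto simp: in_parcs_K xi_closed tau_closed)
qed

lemma path_product_closed:
  assumes "set p \<subseteq> parcs (K n)"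
  shows "path_product n p \<in> carrier (A n)"
proof -
  interpret A: cring "A n" by (rule A_cring)
  show ?thesis
    using assms by (induction p) (auto simp: path_product_def edge_label_closed)
qed

text \<open>The product is folded from the front, whereas the recursion removes edges at the back;
  associativity bridges the two.\<close>

lemma path_product_snoc:
  assumes "set p \<subseteq> parcs (K n)" "e \<in> parcs (K n)"
  shows "path_product n (p @ [e]) = path_product n p \<otimes>\<^bsub>A n\<^esub> edge_label n e"
proof -
  interpret A: cring "A n" by (rule A_cring)
  show ?thesis
    using assms(1)
  proof (induction p)
    case Nil
    show ?case using assms(2) by (simp add: path_product_def edge_label_closed)
  next
    case (Cons f p)
    then have "path_product n p \<in> carrier (A n)" "edge_label n f \<in> carrier (A n)"
      by (simp_all add: path_product_closed edge_label_closed)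
    moreover have "path_product n ((f # p) @ [e]) =
        edge_label n f \<otimes>\<^bsub>A n\<^esub> path_product n (p @ [e])"
      "path_product n (f # p) = edge_label n f \<otimes>\<^bsub>A n\<^esub> path_product n p"
      by (simp_all add: path_product_def)
    ultimately show ?case
      using Cons assms(2) by (simp add: A.m_assoc edge_label_closed)
  qed
qed

lemma directed_paths_arcs: "p \<in> directed_paths n u v \<Longrightarrow> set p \<subseteq> parcs (K n)"
proof -
  assume p: "p \<in> directed_paths n u v"
  interpret wf_digraph "with_proj (K n)" by (rule wf_digraph_K)
  show ?thesis
    using p by (auto simp: directed_paths_awalk awalk_def)
qed

lemma directed_path_product_closed:
  "p \<in> directed_paths n u v \<Longrightarrow> path_product n p \<in> carrier (A n)"
  by (intro path_product_closed directed_paths_arcs)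

lemma path_sum_closed: "path_sum n u v \<in> carrier (A n)"
proof -
  interpret A: cring "A n" by (rule A_cring)
  show ?thesis
    unfolding path_sum_def by (intro A.finsum_closed) (auto intro: directed_path_product_closed)
qed

lemma path_sum_self:
  assumes "v \<in> pverts (K n)"
  shows "path_sum n v v = \<one>\<^bsub>A n\<^esub>"
proof -
  interpret A: cring "A n" by (rule A_cring)
  show ?thesis
    by (simp add: path_sum_def directed_paths_self[OF assms] path_product_def)
qed

lemma path_sum_zero:
  assumes "u \<noteq> v" "\<not> before u v"
  shows "path_sum n u v = \<zero>\<^bsub>A n\<^esub>"
proof -
  interpret A: cring "A n" by (rule A_cring)
  show ?thesis
    by (simp add: path_sum_def directed_paths_empty[OF assms])
qed

text \<open>Group the paths by their last edge and use distributivity to take its label out of each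
  group.\<close>

lemma path_sum_last_edge:
  assumes "u \<noteq> w"
  shows "path_sum n u w =
    (\<Oplus>\<^bsub>A n\<^esub> v \<in> {v. (v, w) \<in> parcs (K n)}. path_sum n u v \<otimes>\<^bsub>A n\<^esub> edge_label n (v, w))"
proof -
  interpret A: cring "A n" by (rule A_cring)
  let ?V = "{v. (v, w) \<in> parcs (K n)}"
  let ?ext = "\<lambda>v p. p @ [(v, w)]"
  \<comment> \<open>A \<open>finsum\<close> over an infinite set is zero by convention, so
    finiteness is what makes the regrouping meaningful.\<close>
  have fin: "finite ?V"
    by (rule finite_subset[of _ "pverts (K n)"]) (auto simp: in_parcs_K pverts_K)
  have snoc: "path_product n (?ext v p) = path_product n p \<otimes>\<^bsub>A n\<^esub> edge_label n (v, w)"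
    if "v \<in> ?V" "p \<in> directed_paths n u v" for v p
    using that by (intro path_product_snoc directed_paths_arcs) auto
  have closed: "path_product n q \<in> carrier (A n)"
    if "v \<in> ?V" "q \<in> ?ext v ` directed_paths n u v" for v q
  proof -
    from that(2) obtain p where p: "p \<in> directed_paths n u v" "q = ?ext v p" by blast
    with that(1) show ?thesis
      by (simp add: snoc directed_path_product_closed edge_label_closed)
  qed
  have "path_sum n u w =
      (\<Oplus>\<^bsub>A n\<^esub> q \<in> (\<Union>v\<in>?V. ?ext v ` directed_paths n u v). path_product n q)"
    by (simp only: path_sum_def directed_paths_last_edge[OF assms])
  also have "\<dots> = (\<Oplus>\<^bsub>A n\<^esub> v \<in> ?V. \<Oplus>\<^bsub>A n\<^esub> q \<in> ?ext v ` directed_paths n u v. path_product n q)"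
    \<comment> \<open>The groups are disjoint because \<open>v\<close> can be read off from the last
      edge.\<close>
    by (rule A.add.finprod_UN_disjoint)
      (use fin closed in \<open>auto simp: finite_directed_paths pairwise_def disjnt_def\<close>)
  also have "\<dots> = (\<Oplus>\<^bsub>A n\<^esub> v \<in> ?V. path_sum n u v \<otimes>\<^bsub>A n\<^esub> edge_label n (v, w))"
  proof (rule A.finsum_cong', simp)
    show "(\<lambda>v. path_sum n u v \<otimes>\<^bsub>A n\<^esub> edge_label n (v, w)) \<in> ?V \<rightarrow> carrier (A n)"
      by (auto intro!: A.m_closed path_sum_closed edge_label_closed)
  next
    fix v assume v: "v \<in> ?V"
    have "(\<Oplus>\<^bsub>A n\<^esub> q \<in> ?ext v ` directed_paths n u v. path_product n q) =
        (\<Oplus>\<^bsub>A n\<^esub> p \<in> directed_paths n u v. path_product n (?ext v p))"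
      using closed[OF v] by (intro A.finsum_reindex) (auto simp: inj_on_def)
    also have "\<dots> = (\<Oplus>\<^bsub>A n\<^esub> p \<in> directed_paths n u v.
        path_product n p \<otimes>\<^bsub>A n\<^esub> edge_label n (v, w))"
      using v by (intro A.finsum_cong')
        (auto simp: snoc intro!: A.m_closed directed_path_product_closed edge_label_closed)
    also have "\<dots> = path_sum n u v \<otimes>\<^bsub>A n\<^esub> edge_label n (v, w)"
      unfolding path_sum_def using v
      by (intro A.finsum_ldistr[symmetric])
        (auto simp: finite_directed_paths intro: edge_label_closed directed_path_product_closed)
    finally show "(\<Oplus>\<^bsub>A n\<^esub> q \<in> ?ext v ` directed_paths n u v. path_product n q) =
        path_sum n u v \<otimes>\<^bsub>A n\<^esub> edge_label n (v, w)" .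
  qed
  finally show ?thesis .
qed

section \<open>Recursions for the path sums\<close>

lemma predecessors_Rho:
  "m \<le> n \<Longrightarrow> {v. (v, Rho_v m) \<in> parcs (K n)} = insert Sigma_v (Rho_v ` {..<m})"
  by (auto simp: in_parcs_K pverts_K)

text \<open>Only the predecessors \<open>Rho_v (k + j)\<close> with \<open>k < i\<close> are
  reachable from \<open>Rho_v j\<close>. The edge from there has index
  \<open>(i + j) - (k + j) = i - k\<close>, and its exponent depends on its source. The term
  \<open>k = 0\<close> is the path with a single edge.\<close>

lemma path_sum_Rho_Rho:
  assumes "1 \<le> i" "i + j \<le> n"
  shows "path_sum n (Rho_v j) (Rho_v (i + j)) =
    (\<Oplus>\<^bsub>A n\<^esub> k \<in> {..<i}. xi n (i - k) [^]\<^bsub>A n\<^esub> ((2::nat) ^ (k + j)) \<otimes>\<^bsub>A n\<^esub>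
       path_sum n (Rho_v j) (Rho_v (k + j)))"
proof -
  interpret A: cring "A n" by (rule A_cring)
  let ?t = "\<lambda>v. path_sum n (Rho_v j) v \<otimes>\<^bsub>A n\<^esub> edge_label n (v, Rho_v (i + j))"
  have V: "{v. (v, Rho_v (i + j)) \<in> parcs (K n)} = insert Sigma_v (Rho_v ` {..<i + j})"
    using assms by (intro predecessors_Rho)
  have closed: "edge_label n (v, Rho_v (i + j)) \<in> carrier (A n)"
    if "v \<in> insert Sigma_v (Rho_v ` {..<i + j})" for v
    using that V by (intro edge_label_closed) auto
  have "path_sum n (Rho_v j) (Rho_v (i + j)) =
      (\<Oplus>\<^bsub>A n\<^esub> v \<in> insert Sigma_v (Rho_v ` {..<i + j}). ?t v)"
    using assms V by (subst path_sum_last_edge) auto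
  also have "\<dots> = (\<Oplus>\<^bsub>A n\<^esub> v \<in> (\<lambda>k. Rho_v (k + j)) ` {..<i}. ?t v)"
  proof (rule A.add.finprod_mono_neutral_cong_right)
    show "?t v = \<zero>\<^bsub>A n\<^esub>"
      if v: "v \<in> insert Sigma_v (Rho_v ` {..<i + j}) - (\<lambda>k. Rho_v (k + j)) ` {..<i}" for v
    proof -
      have "path_sum n (Rho_v j) v = \<zero>\<^bsub>A n\<^esub>"
      proof (cases v)
        case Sigma_v
        then show ?thesis by (simp add: path_sum_zero)
      next
        case (Rho_v b)
        \<comment> \<open>Otherwise \<open>b - j\<close> is an exact difference below
          \<open>i\<close>, and \<open>v\<close> would lie in the image that was removed.\<close>
        have "b < j"
        proof (rule ccontr)
          assume "\<not> b < j"
          with v Rho_v have "v = Rho_v ((b - j) + j)" "b - j < i" by auto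
          with v show False by blast
        qed
        with Rho_v show ?thesis by (simp add: path_sum_zero)
      qed
      with v closed show ?thesis by simp
    qed
  qed (use closed in \<open>auto intro!: A.m_closed path_sum_closed simp del: edge_label.simps\<close>)
  also have "\<dots> = (\<Oplus>\<^bsub>A n\<^esub> k \<in> {..<i}. ?t (Rho_v (k + j)))"
    using closed by (intro A.finsum_reindex)
      (auto simp: inj_on_def intro!: A.m_closed path_sum_closed simp del: edge_label.simps)
  also have "\<dots> = (\<Oplus>\<^bsub>A n\<^esub> k \<in> {..<i}. xi n (i - k) [^]\<^bsub>A n\<^esub> ((2::nat) ^ (k + j)) \<otimes>\<^bsub>A n\<^esub>
       path_sum n (Rho_v j) (Rho_v (k + j)))"
    by (intro A.finsum_cong') (auto simp: A.m_comm path_sum_closed xi_closed)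
  finally show ?thesis .
qed

text \<open>The summand \<open>tau n i\<close> is the direct edge, reached through the empty path at
  \<open>Sigma_v\<close>. For \<open>i = 0\<close> it is the only path.\<close>

lemma path_sum_Sigma_Rho:
  assumes "i \<le> n"
  shows "path_sum n Sigma_v (Rho_v i) = tau n i \<oplus>\<^bsub>A n\<^esub>
    (\<Oplus>\<^bsub>A n\<^esub> k \<in> {..<i}. xi n (i - k) [^]\<^bsub>A n\<^esub> ((2::nat) ^ k) \<otimes>\<^bsub>A n\<^esub>
       path_sum n Sigma_v (Rho_v k))"
proof -
  interpret A: cring "A n" by (rule A_cring)
  let ?t = "\<lambda>v. path_sum n Sigma_v v \<otimes>\<^bsub>A n\<^esub> edge_label n (v, Rho_v i)"
  have "path_sum n Sigma_v (Rho_v i) = (\<Oplus>\<^bsub>A n\<^esub> v \<in> insert Sigma_v (Rho_v ` {..<i}). ?t v)"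
    using assms by (subst path_sum_last_edge) (auto simp: predecessors_Rho)
  also have "\<dots> = ?t Sigma_v \<oplus>\<^bsub>A n\<^esub> (\<Oplus>\<^bsub>A n\<^esub> v \<in> Rho_v ` {..<i}. ?t v)"
    by (rule A.finsum_insert) (auto intro!: A.m_closed path_sum_closed simp: xi_closed tau_closed)
  also have "?t Sigma_v = tau n i"
    by (simp add: path_sum_self pverts_K tau_closed)
  also have "(\<Oplus>\<^bsub>A n\<^esub> v \<in> Rho_v ` {..<i}. ?t v) = (\<Oplus>\<^bsub>A n\<^esub> k \<in> {..<i}. ?t (Rho_v k))"
    by (intro A.finsum_reindex) (auto intro!: A.m_closed path_sum_closed simp: xi_closed inj_on_def)
  also have "\<dots> = (\<Oplus>\<^bsub>A n\<^esub> k \<in> {..<i}. xi n (i - k) [^]\<^bsub>A n\<^esub> ((2::nat) ^ k) \<otimes>\<^bsub>A n\<^esub>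
       path_sum n Sigma_v (Rho_v k))"
    by (intro A.finsum_cong') (auto simp: A.m_comm path_sum_closed xi_closed)
  finally show ?thesis .
qed


section \<open>The antipode\<close>

lemma antipode_closed: "is_antipode n c \<Longrightarrow> x \<in> carrier (A n) \<Longrightarrow> c x \<in> carrier (A n)"
  by (auto simp: is_antipode_def ring_hom_def)

text \<open>The term \<open>k = m\<close> of the defining relation is \<open>c (xi n m)\<close>
  itself; in characteristic two the other terms change sides without a sign.\<close>

lemma antipode_xi:
  assumes c: "is_antipode n c" and m: "1 \<le> m" "m \<le> n"
  shows "c (xi n m) =
    (\<Oplus>\<^bsub>A n\<^esub> k \<in> {..<m}. xi n (m - k) [^]\<^bsub>A n\<^esub> ((2::nat) ^ k) \<otimes>\<^bsub>A n\<^esub> c (xi n k))"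
    (is "_ = ?S")
proof -
  interpret A: cring "A n" by (rule A_cring)
  let ?f = "\<lambda>k. xi n (m - k) [^]\<^bsub>A n\<^esub> ((2::nat) ^ k) \<otimes>\<^bsub>A n\<^esub> c (xi n k)"
  have f: "?f k \<in> carrier (A n)" for k
    using c by (simp add: xi_closed antipode_closed)
  have S: "?S \<in> carrier (A n)"
    using f by (intro A.finsum_closed) auto
  have cm: "c (xi n m) \<in> carrier (A n)"
    using c by (simp add: xi_closed antipode_closed)
  have "{0..m} = insert m {..<m}" by auto
  then have "(\<Oplus>\<^bsub>A n\<^esub> k \<in> {0..m}. ?f k) = ?f m \<oplus>\<^bsub>A n\<^esub> ?S"
    using f f[of m] by simp
  also have "?f m = c (xi n m)"
    using cm by (simp add: xi_0)
  finally have "c (xi n m) \<oplus>\<^bsub>A n\<^esub> ?S = \<zero>\<^bsub>A n\<^esub>"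
    using c m unfolding is_antipode_def by simp
  then show ?thesis
    by (rule A.eq_if_add_eq_zero_char_2[OF A_one_add_one cm S])
qed

text \<open>Solved as for \<open>xi\<close>; the extra summand \<open>tau n m\<close> of the
  relation survives and will match the direct edge from \<open>Sigma_v\<close>.\<close>

lemma antipode_tau:
  assumes c: "is_antipode n c" and m: "m \<le> n"
  shows "c (tau n m) = tau n m \<oplus>\<^bsub>A n\<^esub>
    (\<Oplus>\<^bsub>A n\<^esub> k \<in> {..<m}. xi n (m - k) [^]\<^bsub>A n\<^esub> ((2::nat) ^ k) \<otimes>\<^bsub>A n\<^esub> c (tau n k))"
    (is "_ = _ \<oplus>\<^bsub>A n\<^esub> ?S")
proof -
  interpret A: cring "A n" by (rule A_cring)
  let ?f = "\<lambda>k. xi n (m - k) [^]\<^bsub>A n\<^esub> ((2::nat) ^ k) \<otimes>\<^bsub>A n\<^esub> c (tau n k)"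
  have f: "?f k \<in> carrier (A n)" for k
    using c by (simp add: xi_closed tau_closed antipode_closed)
  have S: "?S \<in> carrier (A n)"
    using f by (intro A.finsum_closed) auto
  have cm: "c (tau n m) \<in> carrier (A n)"
    using c by (simp add: tau_closed antipode_closed)
  have "{0..m} = insert m {..<m}" by auto
  then have "(\<Oplus>\<^bsub>A n\<^esub> k \<in> {0..m}. ?f k) = ?f m \<oplus>\<^bsub>A n\<^esub> ?S"
    using f f[of m] by simp
  also have "?f m = c (tau n m)"
    using cm by (simp add: xi_0)
  finally have sum: "(\<Oplus>\<^bsub>A n\<^esub> k \<in> {0..m}. ?f k) = c (tau n m) \<oplus>\<^bsub>A n\<^esub> ?S" .
  have "tau n m \<oplus>\<^bsub>A n\<^esub> (\<Oplus>\<^bsub>A n\<^esub> k \<in> {0..m}. ?f k) = \<zero>\<^bsub>A n\<^esub>"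
    using c m unfolding is_antipode_def by blast
  then have "tau n m \<oplus>\<^bsub>A n\<^esub> (c (tau n m) \<oplus>\<^bsub>A n\<^esub> ?S) = \<zero>\<^bsub>A n\<^esub>"
    by (simp only: sum)
  then have "c (tau n m) \<oplus>\<^bsub>A n\<^esub> (tau n m \<oplus>\<^bsub>A n\<^esub> ?S) = \<zero>\<^bsub>A n\<^esub>"
    using cm S tau_closed by (simp add: A.a_lcomm)
  then show ?thesis
    using A.eq_if_add_eq_zero_char_2[OF A_one_add_one cm] S tau_closed by simp
qed

text \<open>Strong induction on \<open>i\<close> with \<open>j\<close> fixed. Frobenius turns the
  recursion for \<open>c (xi n i)\<close> into one for its power, and raising
  \<open>xi n (i - k)\<close> to \<open>2 ^ k\<close> and then to \<open>2 ^ j\<close> gives the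
  exponent \<open>2 ^ (k + j)\<close> of the edge label.\<close>

lemma antipode_xi_power:
  assumes c: "is_antipode n c"
  shows "i + j \<le> n \<Longrightarrow> c (xi n i) [^]\<^bsub>A n\<^esub> ((2::nat) ^ j) = path_sum n (Rho_v j) (Rho_v (i + j))"
proof (induction i rule: less_induct)
  case (less i)
  interpret A: cring "A n" by (rule A_cring)
  show ?case
  proof (cases "i = 0")
    \<comment> \<open>The case \<open>i = 0\<close> is included because the recursion reaches
      \<open>k = 0\<close>; there both sides are one, the path sum consisting of the empty
      path.\<close>
    case True
    have "c (xi n 0) = \<one>\<^bsub>A n\<^esub>"
      using c by (simp add: is_antipode_def)
    with True less.prems show ?thesis
      by (simp add: path_sum_self pverts_K)
  next
    case False
    have cl: "c (xi n k) \<in> carrier (A n)" for k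
      using c by (simp add: xi_closed antipode_closed)
    have "c (xi n i) [^]\<^bsub>A n\<^esub> ((2::nat) ^ j) =
        (\<Oplus>\<^bsub>A n\<^esub> k \<in> {..<i}. xi n (i - k) [^]\<^bsub>A n\<^esub> ((2::nat) ^ k) \<otimes>\<^bsub>A n\<^esub> c (xi n k))
          [^]\<^bsub>A n\<^esub> ((2::nat) ^ j)"
      using antipode_xi[OF c, of i] False less.prems by simp
    also have "\<dots> = (\<Oplus>\<^bsub>A n\<^esub> k \<in> {..<i}.
        (xi n (i - k) [^]\<^bsub>A n\<^esub> ((2::nat) ^ k) \<otimes>\<^bsub>A n\<^esub> c (xi n k)) [^]\<^bsub>A n\<^esub> ((2::nat) ^ j))"
      by (rule A.frobenius_finsum_char_2[OF A_one_add_one]) (auto simp: xi_closed cl)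
    also have "\<dots> = (\<Oplus>\<^bsub>A n\<^esub> k \<in> {..<i}. xi n (i - k) [^]\<^bsub>A n\<^esub> ((2::nat) ^ (k + j)) \<otimes>\<^bsub>A n\<^esub>
       path_sum n (Rho_v j) (Rho_v (k + j)))"
    proof (rule A.finsum_cong', simp)
      fix k assume "k \<in> {..<i}"
      then have "c (xi n k) [^]\<^bsub>A n\<^esub> ((2::nat) ^ j) = path_sum n (Rho_v j) (Rho_v (k + j))"
        using less by simp
      then show "(xi n (i - k) [^]\<^bsub>A n\<^esub> ((2::nat) ^ k) \<otimes>\<^bsub>A n\<^esub> c (xi n k)) [^]\<^bsub>A n\<^esub> ((2::nat) ^ j) =
          xi n (i - k) [^]\<^bsub>A n\<^esub> ((2::nat) ^ (k + j)) \<otimes>\<^bsub>A n\<^esub> path_sum n (Rho_v j) (Rho_v (k + j))"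
        by (simp add: A.nat_pow_distrib A.nat_pow_pow xi_closed cl power_add)
    qed (auto simp: xi_closed path_sum_closed)
    also have "\<dots> = path_sum n (Rho_v j) (Rho_v (i + j))"
      using False less.prems by (intro path_sum_Rho_Rho[symmetric]) auto
    finally show ?thesis .
  qed
qed

text \<open>Both sides satisfy the same recursion, so strong induction identifies them; no Frobenius
  power is involved.\<close>

lemma antipode_tau_path_sum:
  assumes c: "is_antipode n c"
  shows "i \<le> n \<Longrightarrow> c (tau n i) = path_sum n Sigma_v (Rho_v i)"
proof (induction i rule: less_induct)
  case (less i)
  interpret A: cring "A n" by (rule A_cring)
  have "(\<Oplus>\<^bsub>A n\<^esub> k \<in> {..<i}. xi n (i - k) [^]\<^bsub>A n\<^esub> ((2::nat) ^ k) \<otimes>\<^bsub>A n\<^esub> c (tau n k)) =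
      (\<Oplus>\<^bsub>A n\<^esub> k \<in> {..<i}. xi n (i - k) [^]\<^bsub>A n\<^esub> ((2::nat) ^ k) \<otimes>\<^bsub>A n\<^esub>
        path_sum n Sigma_v (Rho_v k))"
    using less by (intro A.finsum_cong') (auto simp: xi_closed path_sum_closed)
  then show ?case
    using less.prems by (simp add: antipode_tau[OF c] path_sum_Sigma_Rho)
qed

theorem theorem4p13:
  fixes n :: nat and c :: "gpoly set \<Rightarrow> gpoly set"
  assumes "is_antipode n c"
  shows "(\<forall>i j. 1 \<le> i \<and> i + j \<le> n \<longrightarrow>
           c (xi n i [^]\<^bsub>A n\<^esub> ((2::nat) ^ j)) = path_sum n (Rho_v j) (Rho_v (i + j))) \<and>
         (\<forall>i \<le> n. c (tau n i) = path_sum n Sigma_v (Rho_v i))"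
proof -
  interpret A: cring "A n" by (rule A_cring)
  interpret c: ring_hom_ring "A n" "A n" c
    using assms by (intro ring_hom_ringI2) (auto simp: is_antipode_def A.ring_axioms)
  \<comment> \<open>Being multiplicative, \<open>c\<close> commutes with powers, which reduces the
    first claim to powers of \<open>c (xi n i)\<close>.\<close>
  have "c (xi n i [^]\<^bsub>A n\<^esub> ((2::nat) ^ j)) = c (xi n i) [^]\<^bsub>A n\<^esub> ((2::nat) ^ j)" for i j
    by (simp add: c.hom_nat_pow xi_closed)
  then show ?thesis
    using antipode_xi_power[OF assms] antipode_tau_path_sum[OF assms] by simp
qed

end
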